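(* Let $\alpha>0$ and let $n\in\mathbb{N}$ satisfy $n-1\le\alpha<n$. The Caputo derivative formula $$D^\alpha f(t)=\frac{1}{\Gamma(n+1-\alpha)}\int_0^{t^{n-\alpha}} f^{(n)}\bigl(t-u^{\frac{1}{n-\alpha}}\bigr)\,du$$ is equivalent to $$D^\alpha f(t)=\frac{1}{\Gamma(n+1-\alpha)}\lim_{h_{\max}\to 0}\ \sum_{k=1}^{m}\frac{f^{(n)}(x_k)+f^{(n)}(x_{k-1})}{2}\cdot\Bigl((t-x_{k-1})^{n-\alpha}-(t-x_k)^{n-\alpha}\Bigr),$$ where $0=x_0<x_1<\dots<x_m=t$, $h_k=x_k-x_{k-1}>0$, $h_{\max}=\max_k\{h_k\}$, $h_{\max}\to 0$ as $m\to\infty$, and $m\cdot h_{\max}\le C(t)<\infty$. Moreover, the order of approximation of the Caputo derivative through $$D^\alpha f(t)\approx\frac{1}{\Gamma(n+1-\alpha)}\sum_{k=1}^{m}\frac{f^{(n)}(x_k)+f^{(n)}(x_{k-1})}{2}\cdot(u_{k-1}-u_k),\qquad u_k=(t-x_k)^{n-\alpha},$$ is at least $O(h_{\max}^{\,n-\alpha+1})$.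
   Context: For $\alpha>0$ and $n\in\mathbb{N}$ with $n-1\le\alpha<n$, the Caputo fractional derivative of order $\alpha$ of a function $f$ (with base point $0$) is $$D^\alpha f(t)=\frac{1}{\Gamma(n-\alpha)}\int_0^t\frac{f^{(n)}(x)}{(t-x)^{\alpha-n+1}}\,dx,$$ where $\Gamma$ is the gamma function. The substitution $u=(t-x)^{n-\alpha}$ removes the singularity and gives the representation $$D^\alpha f(t)=\frac{1}{\Gamma(n+1-\alpha)}\int_0^{t^{n-\alpha}} f^{(n)}\bigl(t-u^{\frac{1}{n-\alpha}}\bigr)\,du.$$ The approximating sum is the trapezoidal rule applied to this integral with nodes $u_k=(t-x_k)^{n-\alpha}$. The steps $h_k$ need not be constant.
   Formalization: The English names no smoothness of f; here f is C^n on [0,t] for the formula and limit, and C^(n+2) for the order O(h_max^(n-α+1)), which fails otherwise (α = n-1, f^(n)(x) = √x gives only order 3/2). *)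

theory Defs
  imports "HOL-Analysis.Analysis" "HOL-Library.Landau_Symbols"
begin

(* The derivative relative to S is one-sided at the endpoints of a closed interval S
   and is the usual derivative in its interior. *)
definition higher_deriv_within :: "real set \<Rightarrow> nat \<Rightarrow> (real \<Rightarrow> real) \<Rightarrow> real \<Rightarrow> real" where
  "higher_deriv_within S k f = ((\<lambda>g x. vector_derivative g (at x within S)) ^^ k) f"

definition C_k_on :: "nat \<Rightarrow> real set \<Rightarrow> (real \<Rightarrow> real) \<Rightarrow> bool" where
  "C_k_on k S f \<longleftrightarrow>
     (\<forall>j<k. higher_deriv_within S j f differentiable_on S) \<and>
     continuous_on S (higher_deriv_within S k f)"

(* Meant for n - 1 \<le> \<alpha> < n, which determines n. The value of the integrand at the
   singular endpoint x = t is irrelevant. *)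
definition caputo :: "real \<Rightarrow> nat \<Rightarrow> (real \<Rightarrow> real) \<Rightarrow> real \<Rightarrow> real" where
  "caputo \<alpha> n f t =
     1 / Gamma (real n - \<alpha>) *
     integral {0..t}
       (\<lambda>x. higher_deriv_within {0..t} n f x / (t - x) powr (\<alpha> - real n + 1))"

(* A mesh with m subintervals is a pair (m, x); only the values x 0, ..., x m matter. *)
definition is_mesh :: "real \<Rightarrow> nat \<Rightarrow> (nat \<Rightarrow> real) \<Rightarrow> bool" where
  "is_mesh t m x \<longleftrightarrow> m \<ge> 1 \<and> x 0 = 0 \<and> x m = t \<and> (\<forall>k\<in>{1..m}. x (k - 1) < x k)"

definition h_max :: "nat \<Rightarrow> (nat \<Rightarrow> real) \<Rightarrow> real" where
  "h_max m x = Max ((\<lambda>k. x k - x (k - 1)) ` {1..m})"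

(* The limit h_max \<rightarrow> 0 over all meshes of [0, t] with m * h_max \<le> C.
   Since t \<le> m * h_max for every mesh, m tends to infinity along this filter. *)
definition fine_meshes :: "real \<Rightarrow> real \<Rightarrow> (nat \<times> (nat \<Rightarrow> real)) filter" where
  "fine_meshes t C =
     inf (filtercomap (\<lambda>(m, x). h_max m x) (at_right 0))
         (principal {(m, x). is_mesh t m x \<and> real m * h_max m x \<le> C})"

definition caputo_trapezoid ::
    "real \<Rightarrow> nat \<Rightarrow> (real \<Rightarrow> real) \<Rightarrow> real \<Rightarrow> nat \<Rightarrow> (nat \<Rightarrow> real) \<Rightarrow> real" where
  "caputo_trapezoid \<alpha> n f t m x =
     1 / Gamma (real n + 1 - \<alpha>) *
     (\<Sum>k=1..m.
        (higher_deriv_within {0..t} n f (x k) + higher_deriv_within {0..t} n f (x (k - 1))) / 2 *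
        ((t - x (k - 1)) powr (real n - \<alpha>) - (t - x k) powr (real n - \<alpha>)))"

end

theory Submission
  imports Defs
begin

text \<open>Put \<open>\<beta> = n - \<alpha>\<close>, \<open>g\<close> for the \<open>n\<close>-th derivative and \<open>p x = \<beta> * (t - x) powr (\<beta> - 1)\<close> for
  the kernel. Since \<open>u = (t - x) powr \<beta>\<close> has derivative \<open>- p\<close>, both integral formulas for the Caputo
  derivative are the integral of \<open>g * p\<close> over \<open>{0..t}\<close>, divided by \<open>Gamma (\<beta> + 1)\<close>
  (\<open>weighted_integral_substitution\<close>, \<open>caputo_eq_weighted_integral\<close>). Moreover the node weight
  \<open>(t - a) powr \<beta> - (t - b) powr \<beta>\<close> of a panel \<open>{a..b}\<close> is the integral of \<open>p\<close> over it, so the error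
  there is the integral of \<open>(g a + g b) / 2 - g\<close> against \<open>p\<close> (\<open>panel_error_has_integral\<close>).
  Estimating in the variable \<open>x\<close> keeps \<open>g\<close> smooth and the steps equal to \<open>h\<^sub>k\<close>; in the variable \<open>u\<close>
  the step lengths are distorted near \<open>t\<close> and the second derivative of the integrand may be unbounded.

  Convergence: by uniform continuity \<open>(g a + g b) / 2 - g\<close> is at most \<open>\<epsilon>\<close> on every short panel, and
  \<open>p\<close> is nonnegative with total mass \<open>t powr \<beta>\<close>.

  Rate: let \<open>h\<close> be the largest step. With \<open>g\<close> of class \<open>C\<^sup>2\<close>, the deviation \<open>(g a + g b) / 2 - g\<close> is
  \<open>O(h)\<close> pointwise, but its unweighted integral over a panel is \<open>O(h\<^sup>2 (b - a))\<close>. At distance at least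
  \<open>h\<close> from the singularity one replaces \<open>p\<close> by the constant \<open>p a\<close>: the constant part contributes
  \<open>O(h\<^sup>2)\<close> times the mass of \<open>p\<close> on the panel, and the remainder \<open>O(h\<^sup>2) (p b - p a)\<close>, because \<open>p\<close> is
  increasing (\<open>panel_error_refined\<close>). Both telescope, the second one to
  \<open>O(h\<^sup>2) * h powr (\<beta> - 1) = O(h powr (\<beta> + 1))\<close>. The panels closer to \<open>t\<close> lie within distance \<open>2 h\<close>, where
  the mass of \<open>p\<close> is only \<open>(2 h) powr \<beta>\<close>, so that the pointwise bound \<open>O(h)\<close> is enough.
  As \<open>h \<le> t\<close> and \<open>\<beta> \<le> 1\<close>, the terms \<open>O(h\<^sup>2)\<close> are also \<open>O(h powr (\<beta> + 1))\<close>.\<close>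

section \<open>Meshes and the limit over fine meshes\<close>

lemma mesh_mono:
  assumes "is_mesh t m x" "i \<le> j" "j \<le> m"
  shows "x i \<le> x j"
  using assms(2,3)
proof (induction j rule: dec_induct)
  case (step k)
  have "\<forall>k\<in>{1..m}. x (k - 1) < x k" using assms(1) by (simp add: is_mesh_def)
  from bspec[OF this, of "Suc k"] step show ?case by simp
qed simp

lemma mesh_in_interval:
  assumes "is_mesh t m x" "k \<le> m"
  shows "x k \<in> {0..t}"
  using mesh_mono[OF assms(1), of 0 k] mesh_mono[OF assms(1), of k m] assms
  by (auto simp: is_mesh_def)

lemma mesh_step_le_h_max:
  assumes "k \<in> {1..m}"
  shows "x k - x (k - 1) \<le> h_max m x"
  unfolding h_max_def using assms by (intro Max_ge) auto

lemma h_max_bounds: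
  assumes "is_mesh t m x"
  shows "0 < h_max m x" "h_max m x \<le> t"
proof -
  have m: "m \<ge> 1" and steps: "\<forall>k\<in>{1..m}. x (k - 1) < x k"
    using assms by (simp_all add: is_mesh_def)
  have "0 < x 1 - x (1 - 1)" using bspec[OF steps, of 1] m by simp
  also have "\<dots> \<le> h_max m x" using m by (intro mesh_step_le_h_max) auto
  finally show "0 < h_max m x" .
  have "x k - x (k - 1) \<le> t" if "k \<in> {1..m}" for k
    using mesh_in_interval[OF assms, of k] mesh_in_interval[OF assms, of "k - 1"] that by force
  then show "h_max m x \<le> t" unfolding h_max_def using m by (subst Max_le_iff) auto
qed

lemma eventually_fine_meshesI:
  assumes "\<delta> > 0"
    and "\<And>m x. is_mesh t m x \<Longrightarrow> h_max m x < \<delta> \<Longrightarrow> Q (m, x)"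
  shows "eventually Q (fine_meshes t C)"
  unfolding fine_meshes_def eventually_inf_principal eventually_filtercomap
proof (intro exI[of _ "\<lambda>h. h < \<delta>"] conjI allI impI)
  show "\<forall>\<^sub>F h in at_right 0. h < \<delta>"
    using assms(1) by (auto simp: eventually_at_right_field)
qed (use assms(2) in \<open>auto split: prod.splits\<close>)

text \<open>Uniform meshes are arbitrarily fine and have \<open>m * h_max = t\<close>, so the side condition
  \<open>m * h_max \<le> C\<close> leaves enough meshes for limits to be unique.\<close>
lemma fine_meshes_neq_bot:
  assumes "t > 0" "t \<le> C"
  shows "fine_meshes t C \<noteq> bot"
proof
  assume "fine_meshes t C = bot"
  then have "eventually (\<lambda>_. False) (fine_meshes t C)" by simp
  then obtain P where P: "eventually P (at_right (0::real))"
    and none: "\<And>m x. P (h_max m x) \<Longrightarrow> \<not> (is_mesh t m x \<and> real m * h_max m x \<le> C)"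
    unfolding fine_meshes_def eventually_inf_principal eventually_filtercomap
    by (auto split: prod.splits)
  from P obtain b where b: "b > 0" "\<And>h. 0 < h \<Longrightarrow> h < b \<Longrightarrow> P h"
    by (auto simp: eventually_at_right_field)
  obtain m where m: "real m > t / b" using reals_Archimedean2 by blast
  have "t / b > 0" using assms b by simp
  with m have m0: "real m > 0" by linarith
  define x where "x k = real k * (t / real m)" for k
  have step: "x k - x (k - 1) = t / real m" if "k \<in> {1..m}" for k
    using that by (simp add: x_def of_nat_diff left_diff_distrib diff_divide_distrib)
  have h: "h_max m x = t / real m"
  proof -
    have "(\<lambda>k. x k - x (k - 1)) ` {1..m} = {t / real m}"
      using step m0 by (force simp: image_iff)
    then show ?thesis by (simp add: h_max_def)
  qed
  have "is_mesh t m x"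
  proof -
    have "x (k - 1) < x k" if "k \<in> {1..m}" for k
      using step[OF that] m0 assms by (smt (verit) divide_pos_pos)
    then show ?thesis using m0 by (auto simp: is_mesh_def x_def)
  qed
  moreover have "P (h_max m x)"
    unfolding h using m0 assms b m by (intro b(2)) (auto simp: field_simps)
  ultimately show False using none[of m x] assms m0 by (simp add: h)
qed


section \<open>The kernel and the substitution that removes its singularity\<close>

definition caputo_weight :: "real \<Rightarrow> real \<Rightarrow> real \<Rightarrow> real" where
  "caputo_weight \<beta> t x = \<beta> * (t - x) powr (\<beta> - 1)"

lemma caputo_weight_nonneg: "\<beta> > 0 \<Longrightarrow> 0 \<le> caputo_weight \<beta> t x"
  by (simp add: caputo_weight_def)

lemma caputo_weight_mono:
  assumes "0 < \<beta>" "\<beta> \<le> 1" "x \<le> y" "y < t"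
  shows "caputo_weight \<beta> t x \<le> caputo_weight \<beta> t y"
  unfolding caputo_weight_def using assms
  by (intro mult_left_mono powr_mono2') auto

text \<open>The substitution \<open>u = (t - x) powr \<beta>\<close>. If \<open>b = t\<close> and \<open>\<beta> < 1\<close> it is not differentiable at the
  endpoint, but it is continuous there, and the substitution rule tolerates finitely many
  exceptional points.\<close>
lemma weighted_integral_substitution:
  assumes "\<beta> > 0" "a \<le> b" "b \<le> t" and g: "continuous_on {a..b} g"
  shows "((\<lambda>x. g x * caputo_weight \<beta> t x) has_integral
           integral {(t - b) powr \<beta>..(t - a) powr \<beta>} (\<lambda>u. g (t - u powr (1 / \<beta>)))) {a..b}"
proof -
  define w where "w x = (t - x) powr \<beta>" for x
  have w_mono: "w y \<le> w x" if "x \<le> y" "y \<le> t" for x y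
    unfolding w_def using that assms by (intro powr_mono2) auto
  have w_root: "w x powr (1 / \<beta>) = t - x" if "x \<le> t" for x
    using that assms by (simp add: w_def powr_powr)
  have range: "t - u powr (1 / \<beta>) \<in> {a..b}" if "u \<in> {w b..w a}" for u
  proof -
    have "0 \<le> w b" by (simp add: w_def)
    then have u0: "0 \<le> u" using that by simp
    have "w b powr (1 / \<beta>) \<le> u powr (1 / \<beta>)"
      using that u0 assms by (intro powr_mono2) (auto simp: w_def)
    moreover have "u powr (1 / \<beta>) \<le> w a powr (1 / \<beta>)"
      using that u0 assms by (intro powr_mono2) auto
    ultimately show ?thesis using w_root[of a] w_root[of b] assms by auto
  qed
  have cont: "continuous_on {w b..w a} (\<lambda>u. g (t - u powr (1 / \<beta>)))"
  proof (rule continuous_on_compose2[OF g])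
    have "0 \<le> w b" by (simp add: w_def)
    then show "continuous_on {w b..w a} (\<lambda>u. t - u powr (1 / \<beta>))"
      using assms
      by (intro continuous_on_diff continuous_on_powr' continuous_intros) auto
  qed (use range in auto)
  have "((\<lambda>x. (- caputo_weight \<beta> t x) *\<^sub>R g (t - w x powr (1 / \<beta>))) has_integral
      integral {w a..w b} (\<lambda>u. g (t - u powr (1 / \<beta>)))
      - integral {w b..w a} (\<lambda>u. g (t - u powr (1 / \<beta>)))) {a..b}"
  proof (rule has_integral_substitution_general[where s = "{t}"])
    show "w ` {a..b} \<subseteq> {w b..w a}" using w_mono assms by auto
    show "continuous_on {a..b} w"
      unfolding w_def using assms by (intro continuous_on_powr' continuous_intros) auto
    show "(w has_real_derivative - caputo_weight \<beta> t x) (at x within {a..b})"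
      if "x \<in> {a..b} - {t}" for x
      unfolding w_def caputo_weight_def using that assms
      by (auto intro!: derivative_eq_intros simp: powr_diff)
  qed (use assms cont in auto)
  \<comment> \<open>The substitution decreases, so the interval in the other order is empty or a point.\<close>
  moreover have "integral {w a..w b} (\<lambda>u. g (t - u powr (1 / \<beta>))) = 0"
  proof (cases "w a = w b")
    case False
    then have "{w a..w b} = {}" using w_mono[of a b] assms by auto
    then show ?thesis by simp
  qed simp
  ultimately have "((\<lambda>x. caputo_weight \<beta> t x * g (t - w x powr (1 / \<beta>))) has_integral
      integral {w b..w a} (\<lambda>u. g (t - u powr (1 / \<beta>)))) {a..b}"
    by (auto dest: has_integral_neg)
  then have "((\<lambda>x. g x * caputo_weight \<beta> t x) has_integral
      integral {w b..w a} (\<lambda>u. g (t - u powr (1 / \<beta>)))) {a..b}"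
    by (rule has_integral_eq[rotated]) (use w_root assms in auto)
  then show ?thesis by (simp add: w_def)
qed

lemma weighted_integrable:
  assumes "\<beta> > 0" "b \<le> t" "continuous_on {a..b} g"
  shows "(\<lambda>x. g x * caputo_weight \<beta> t x) integrable_on {a..b}"
proof (cases "a \<le> b")
  case True
  then show ?thesis
    using weighted_integral_substitution[OF assms(1) True assms(2,3)] by blast
qed (simp add: integrable_on_empty)

lemma caputo_weight_has_integral:
  assumes "\<beta> > 0" "a \<le> b" "b \<le> t"
  shows "(caputo_weight \<beta> t has_integral ((t - a) powr \<beta> - (t - b) powr \<beta>)) {a..b}"
proof -
  have "(t - b) powr \<beta> \<le> (t - a) powr \<beta>" using assms by (intro powr_mono2) auto
  then show ?thesis
    using weighted_integral_substitution[OF assms, of "\<lambda>_. 1"] by simp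
qed

lemma caputo_eq_weighted_integral:
  assumes "\<alpha> < real n"
  shows "caputo \<alpha> n f t = 1 / Gamma (real n + 1 - \<alpha>) *
    integral {0..t} (\<lambda>x. higher_deriv_within {0..t} n f x * caputo_weight (real n - \<alpha>) t x)"
proof -
  define \<beta> where "\<beta> = real n - \<alpha>"
  have \<beta>: "\<beta> > 0" using assms by (simp add: \<beta>_def)
  have "Gamma (\<beta> + 1) = \<beta> * Gamma \<beta>"
    using \<beta> by (intro Gamma_plus1) (auto elim!: nonpos_Ints_cases)
  then have "Gamma (real n + 1 - \<alpha>) = \<beta> * Gamma \<beta>" by (simp add: \<beta>_def algebra_simps)
  \<comment> \<open>At \<open>x = t\<close> both sides vanish, since \<open>0 powr r = 0\<close> and division by zero gives zero.\<close>
  moreover have "g / (t - x) powr (\<alpha> - real n + 1) = 1 / \<beta> * (g * caputo_weight \<beta> t x)"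
    for x g
  proof -
    have "(t - x) powr (\<beta> - 1) = 1 / (t - x) powr (\<alpha> - real n + 1)"
      unfolding powr_minus_divide[symmetric] by (simp add: \<beta>_def algebra_simps)
    then show ?thesis using \<beta> by (simp add: caputo_weight_def)
  qed
  ultimately show ?thesis
    unfolding caputo_def \<beta>_def[symmetric] by (simp del: of_nat_add)
qed


section \<open>The error on one panel\<close>

definition panel_error :: "real \<Rightarrow> real \<Rightarrow> (real \<Rightarrow> real) \<Rightarrow> real \<Rightarrow> real \<Rightarrow> real" where
  "panel_error \<beta> t g a b =
     (g b + g a) / 2 * ((t - a) powr \<beta> - (t - b) powr \<beta>)
     - integral {a..b} (\<lambda>x. g x * caputo_weight \<beta> t x)"

lemma panel_error_has_integral:
  assumes "\<beta> > 0" "a \<le> b" "b \<le> t" "continuous_on {a..b} g"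
  shows "((\<lambda>x. ((g b + g a) / 2 - g x) * caputo_weight \<beta> t x)
           has_integral panel_error \<beta> t g a b) {a..b}"
  unfolding panel_error_def left_diff_distrib
  using assms
  by (intro has_integral_diff has_integral_mult_right caputo_weight_has_integral
      integrable_integral weighted_integrable)

text \<open>Only the total mass of the kernel enters, so this bound survives the singularity at \<open>b = t\<close>;
  it serves for convergence and for the panels next to \<open>t\<close>.\<close>
lemma panel_error_crude:
  assumes "\<beta> > 0" "a \<le> b" "b \<le> t" "continuous_on {a..b} g"
    and e: "\<And>x. x \<in> {a..b} \<Longrightarrow> \<bar>(g b + g a) / 2 - g x\<bar> \<le> e"
  shows "\<bar>panel_error \<beta> t g a b\<bar> \<le> e * ((t - a) powr \<beta> - (t - b) powr \<beta>)"
proof -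
  note E = panel_error_has_integral[OF assms(1-4)]
  note W = has_integral_mult_right[OF caputo_weight_has_integral[OF assms(1-3)], of e]
  have "norm (integral {a..b} (\<lambda>x. ((g b + g a) / 2 - g x) * caputo_weight \<beta> t x))
      \<le> integral {a..b} (\<lambda>x. e * caputo_weight \<beta> t x)"
    using E W e caputo_weight_nonneg[OF assms(1)]
    by (intro integral_norm_bound_integral) (auto simp: abs_mult intro!: mult_right_mono)
  then show ?thesis unfolding integral_unique[OF E] integral_unique[OF W] by simp
qed

text \<open>Freezing the kernel at \<open>a\<close> exposes the cancellation in the unweighted trapezoidal rule, measured
  by \<open>d\<close>. What is left costs the oscillation \<open>e\<close> of \<open>g\<close> times the increase of the kernel. Both
  terms are increments of a function of the endpoint up to a factor bounded by the step, which is
  what makes them summable over a mesh with arbitrary steps.\<close>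
lemma panel_error_refined:
  assumes \<beta>: "0 < \<beta>" "\<beta> \<le> 1" and ab: "a \<le> b" "b < t" and g: "continuous_on {a..b} g"
    and e: "\<And>x. x \<in> {a..b} \<Longrightarrow> \<bar>(g b + g a) / 2 - g x\<bar> \<le> e"
    and d: "\<bar>integral {a..b} (\<lambda>x. (g b + g a) / 2 - g x)\<bar> \<le> d * (b - a)" "0 \<le> d"
  shows "\<bar>panel_error \<beta> t g a b\<bar> \<le>
    e * (b - a) * (caputo_weight \<beta> t b - caputo_weight \<beta> t a)
    + d * ((t - a) powr \<beta> - (t - b) powr \<beta>)"
proof -
  define p where "p = caputo_weight \<beta> t"
  define r where "r x = (g b + g a) / 2 - g x" for x
  have e0: "0 \<le> e" using e[of a] ab by force
  have "continuous_on {a..b} r" unfolding r_def using g by (intro continuous_intros)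
  then have r: "r integrable_on {a..b}" by (rule integrable_continuous_real)
  have E: "((\<lambda>x. r x * p x) has_integral panel_error \<beta> t g a b) {a..b}"
    unfolding r_def p_def using assms by (intro panel_error_has_integral) auto
  have "((\<lambda>x. r x * p x - r x * p a) has_integral
      panel_error \<beta> t g a b - integral {a..b} r * p a) {a..b}"
    by (intro has_integral_diff E has_integral_mult_left integrable_integral r)
  then have D: "((\<lambda>x. r x * (p x - p a)) has_integral
      panel_error \<beta> t g a b - integral {a..b} r * p a) {a..b}"
    by (simp add: right_diff_distrib)
  have "norm (integral {a..b} (\<lambda>x. r x * (p x - p a)))
      \<le> integral {a..b} (\<lambda>x. e * (p b - p a))"
  proof (intro integral_norm_bound_integral)
    fix x assume x: "x \<in> {a..b}"
    have "p a \<le> p x" "p x \<le> p b"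
      unfolding p_def using x ab \<beta> by (auto intro!: caputo_weight_mono)
    then show "norm (r x * (p x - p a)) \<le> e * (p b - p a)"
      using e[OF x] e0 by (auto simp: abs_mult r_def intro!: mult_mono)
  qed (use D in auto)
  then have main: "\<bar>panel_error \<beta> t g a b - integral {a..b} r * p a\<bar>
      \<le> e * (b - a) * (p b - p a)"
    using integral_unique[OF D] ab by (simp add: algebra_simps)
  \<comment> \<open>The kernel increases, so its left endpoint value underestimates its mean.\<close>
  have "integral {a..b} (\<lambda>x. p a) \<le> integral {a..b} p"
    using caputo_weight_has_integral[OF \<beta>(1) ab(1), of t] ab \<beta>
    by (intro integral_le) (auto simp: p_def intro!: caputo_weight_mono)
  then have mean: "(b - a) * p a \<le> (t - a) powr \<beta> - (t - b) powr \<beta>"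
    using integral_unique[OF caputo_weight_has_integral[OF \<beta>(1) ab(1), of t]] ab
    by (simp add: p_def)
  have "\<bar>integral {a..b} r * p a\<bar> \<le> d * (b - a) * p a"
    using d(1) caputo_weight_nonneg[OF \<beta>(1), of t a]
    by (auto simp: abs_mult p_def r_def[abs_def] intro!: mult_right_mono)
  also have "\<dots> \<le> d * ((t - a) powr \<beta> - (t - b) powr \<beta>)"
    using mult_left_mono[OF mean d(2)] by (simp add: mult.assoc)
  finally show ?thesis using main by (simp add: p_def)
qed

lemma panel_deviation_le:
  fixes g :: "real \<Rightarrow> real"
  assumes "a \<le> b" "x \<in> {a..b}"
    and "\<And>y z. y \<in> {a..b} \<Longrightarrow> z \<in> {a..b} \<Longrightarrow> \<bar>g y - g z\<bar> \<le> e"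
  shows "\<bar>(g b + g a) / 2 - g x\<bar> \<le> e"
proof -
  have "\<bar>g b - g x\<bar> \<le> e" "\<bar>g a - g x\<bar> \<le> e" using assms by auto
  then show ?thesis by (simp add: abs_le_iff field_simps)
qed

text \<open>The trapezoidal rule is exact on the tangent of \<open>g\<close> at \<open>a\<close>, so only the remainder, which the mean
  value theorem bounds by \<open>M * (b - a)^2\<close>, contributes: once through the value at \<open>b\<close> and once
  inside the integral.\<close>
lemma trapezoid_defect_le:
  fixes g g' :: "real \<Rightarrow> real"
  assumes ab: "a \<le> b"
    and g: "\<And>x. x \<in> {a..b} \<Longrightarrow> (g has_real_derivative g' x) (at x within {a..b})"
    and lip: "\<And>x. x \<in> {a..b} \<Longrightarrow> \<bar>g' x - g' a\<bar> \<le> M * (b - a)"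
  shows "\<bar>integral {a..b} (\<lambda>x. (g b + g a) / 2 - g x)\<bar> \<le> 2 * M * (b - a)^2 * (b - a)"
proof -
  define R where "R x = g x - g a - g' a * (x - a)" for x
  have R: "\<bar>R x\<bar> \<le> M * (b - a)^2" if x: "x \<in> {a..b}" for x
  proof -
    have "norm (R x - R a) \<le> (M * (b - a)) * norm (x - a)"
    proof (rule field_differentiable_bound[of "{a..b}" R "\<lambda>x. g' x - g' a"])
      show "(R has_field_derivative g' z - g' a) (at z within {a..b})" if "z \<in> {a..b}" for z
        unfolding R_def using g[OF that] by (auto intro!: derivative_eq_intros)
    qed (use x ab lip in auto)
    also have "\<dots> \<le> (M * (b - a)) * (b - a)"
      using x lip[of a] ab by (intro mult_left_mono) auto
    finally show ?thesis by (simp add: R_def power2_eq_square mult.assoc)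
  qed
  have contg: "continuous_on {a..b} g"
    by (rule DERIV_continuous_on[OF g])
  have contR: "continuous_on {a..b} R"
    unfolding R_def by (intro continuous_intros contg)
  have split: "(g b + g a) / 2 - g x = g' a * ((a + b) / 2 - x) + (R b / 2 - R x)" for x
    by (simp add: R_def field_simps)
  have "((\<lambda>x. (a + b) / 2 - x) has_integral 0) {a..b}"
  proof -
    have "((\<lambda>x. (a + b) / 2 - x) has_integral
        ((a + b) / 2 * b - b^2 / 2) - ((a + b) / 2 * a - a^2 / 2)) {a..b}"
      using ab by (intro fundamental_theorem_of_calculus)
        (auto intro!: derivative_eq_intros simp: has_real_derivative_iff_has_vector_derivative[symmetric])
    then show ?thesis by (simp add: power2_eq_square field_simps)
  qed
  then have "((\<lambda>x. g' a * ((a + b) / 2 - x) + (R b / 2 - R x)) has_integral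
      g' a * 0 + integral {a..b} (\<lambda>x. R b / 2 - R x)) {a..b}"
    by (intro has_integral_add has_integral_mult_right integrable_integral
        integrable_continuous_real continuous_intros contR)
  then have "integral {a..b} (\<lambda>x. (g b + g a) / 2 - g x)
      = integral {a..b} (\<lambda>x. R b / 2 - R x)"
    unfolding split by (simp add: integral_unique)
  also have "norm \<dots> \<le> integral {a..b} (\<lambda>x. 2 * M * (b - a)^2)"
  proof (intro integral_norm_bound_integral)
    fix x assume "x \<in> {a..b}"
    then show "norm (R b / 2 - R x) \<le> 2 * M * (b - a)^2"
      using R[of x] R[of b] ab by (simp add: abs_le_iff)
  qed (auto intro!: integrable_continuous_real continuous_intros contR)
  finally show ?thesis using ab by (simp add: mult_ac)
qed


section \<open>Summing the panel errors\<close>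

text \<open>A panel bound of the form \<open>\<phi> b - \<phi> a\<close> telescopes over the mesh, whatever the
  individual step sizes are.\<close>
lemma mesh_error_le:
  assumes \<beta>: "\<beta> > 0" and g: "continuous_on {0..t} g" and mesh: "is_mesh t m x"
    and bound: "\<And>a b. 0 \<le> a \<Longrightarrow> a \<le> b \<Longrightarrow> b \<le> t \<Longrightarrow> b - a \<le> h_max m x \<Longrightarrow>
      \<bar>panel_error \<beta> t g a b\<bar> \<le> \<phi> b - \<phi> a"
  shows "\<bar>(\<Sum>k=1..m. (g (x k) + g (x (k - 1))) / 2 *
             ((t - x (k - 1)) powr \<beta> - (t - x k) powr \<beta>))
          - integral {0..t} (\<lambda>x. g x * caputo_weight \<beta> t x)\<bar> \<le> \<phi> t - \<phi> 0"
proof -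
  let ?F = "\<lambda>x. g x * caputo_weight \<beta> t x"
  have ends: "x 0 = 0" "x m = t" using mesh by (auto simp: is_mesh_def)
  have combine: "(\<Sum>k=1..j. integral {x (k - 1)..x k} ?F) = integral {0..x j} ?F"
    if "j \<le> m" for j
    using that
  proof (induction j)
    case (Suc j)
    have xs: "0 \<le> x j" "x j \<le> x (Suc j)" "x (Suc j) \<le> t"
      using mesh_in_interval[OF mesh, of j] mesh_in_interval[OF mesh, of "Suc j"]
        mesh_mono[OF mesh, of j "Suc j"] Suc.prems by auto
    then have "integral {0..x j} ?F + integral {x j..x (Suc j)} ?F = integral {0..x (Suc j)} ?F"
      using \<beta> continuous_on_subset[OF g]
      by (intro Henstock_Kurzweil_Integration.integral_combine weighted_integrable) auto
    then show ?case using Suc by simp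
  qed (simp add: ends)
  have tele: "(\<Sum>k=1..m. \<phi> (x k) - \<phi> (x (k - 1))) = \<phi> t - \<phi> 0"
    using sum_telescope''[of 0 m "\<lambda>k. \<phi> (x k)"] by (simp add: ends atLeastSucAtMost_greaterThanAtMost)
  have "(\<Sum>k=1..m. (g (x k) + g (x (k - 1))) / 2 *
             ((t - x (k - 1)) powr \<beta> - (t - x k) powr \<beta>)) - integral {0..t} ?F
      = (\<Sum>k=1..m. panel_error \<beta> t g (x (k - 1)) (x k))"
    unfolding panel_error_def sum_subtractf by (simp only: combine[OF order_refl] ends)
  also have "\<bar>\<dots>\<bar> \<le> (\<Sum>k=1..m. \<bar>panel_error \<beta> t g (x (k - 1)) (x k)\<bar>)"
    by (rule sum_abs)
  also have "\<dots> \<le> (\<Sum>k=1..m. \<phi> (x k) - \<phi> (x (k - 1)))"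
  proof (intro sum_mono bound)
    fix k assume k: "k \<in> {1..m}"
    show "0 \<le> x (k - 1)" "x k \<le> t" "x (k - 1) \<le> x k"
      using mesh_in_interval[OF mesh, of k] mesh_in_interval[OF mesh, of "k - 1"]
        mesh_mono[OF mesh, of "k - 1" k] k by auto
    show "x k - x (k - 1) \<le> h_max m x" by (rule mesh_step_le_h_max[OF k])
  qed
  finally show ?thesis by (simp only: tele)
qed

lemma trapezoid_tendsto_weighted_integral:
  assumes \<beta>: "\<beta> > 0" and t: "t > 0" and g: "continuous_on {0..t} g"
  shows "((\<lambda>(m, x). \<Sum>k=1..m. (g (x k) + g (x (k - 1))) / 2 *
             ((t - x (k - 1)) powr \<beta> - (t - x k) powr \<beta>))
          \<longlongrightarrow> integral {0..t} (\<lambda>x. g x * caputo_weight \<beta> t x)) (fine_meshes t C)"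
proof (rule tendstoI)
  fix \<epsilon> :: real assume \<epsilon>: "\<epsilon> > 0"
  define e where "e = \<epsilon> / (2 * t powr \<beta>)"
  have e: "e > 0" "e * t powr \<beta> < \<epsilon>" using \<epsilon> t by (auto simp: e_def)
  have "uniformly_continuous_on {0..t} g"
    by (rule compact_uniformly_continuous[OF g]) simp
  then obtain \<delta> where \<delta>: "\<delta> > 0"
    "\<And>y z. y \<in> {0..t} \<Longrightarrow> z \<in> {0..t} \<Longrightarrow> \<bar>y - z\<bar> < \<delta> \<Longrightarrow> \<bar>g y - g z\<bar> < e"
    using e unfolding uniformly_continuous_on_def dist_real_def by metis
  show "\<forall>\<^sub>F mx in fine_meshes t C. dist (case mx of (m, x) \<Rightarrow>
      \<Sum>k=1..m. (g (x k) + g (x (k - 1))) / 2 *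
             ((t - x (k - 1)) powr \<beta> - (t - x k) powr \<beta>))
      (integral {0..t} (\<lambda>x. g x * caputo_weight \<beta> t x)) < \<epsilon>"
  proof (rule eventually_fine_meshesI[OF \<delta>(1)])
    fix m x assume mesh: "is_mesh t m x" and h: "h_max m x < \<delta>"
    have "\<bar>panel_error \<beta> t g a b\<bar> \<le> - e * (t - b) powr \<beta> - (- e * (t - a) powr \<beta>)"
      if ab: "0 \<le> a" "a \<le> b" "b \<le> t" "b - a \<le> h_max m x" for a b
    proof -
      have "\<bar>g y - g z\<bar> \<le> e" if "y \<in> {a..b}" "z \<in> {a..b}" for y z
        using that ab h by (intro less_imp_le \<delta>(2)) (auto simp: abs_less_iff)
      then have "\<bar>panel_error \<beta> t g a b\<bar> \<le> e * ((t - a) powr \<beta> - (t - b) powr \<beta>)"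
        using ab \<beta> continuous_on_subset[OF g]
        by (intro panel_error_crude panel_deviation_le) auto
      then show ?thesis by (simp add: algebra_simps)
    qed
    from mesh_error_le[where \<phi> = "\<lambda>x. - e * (t - x) powr \<beta>", OF \<beta> g mesh this]
    show "dist (case (m, x) of (m, x) \<Rightarrow>
      \<Sum>k=1..m. (g (x k) + g (x (k - 1))) / 2 *
             ((t - x (k - 1)) powr \<beta> - (t - x k) powr \<beta>))
      (integral {0..t} (\<lambda>x. g x * caputo_weight \<beta> t x)) < \<epsilon>"
      using e by (simp add: dist_real_def)
  qed
qed

text \<open>The constant has three parts: the curvature of \<open>g\<close> on all panels away from the singularity, the
  growth of the kernel on those panels, and the panels near \<open>t\<close>.\<close>
lemma trapezoid_error_rate:
  assumes \<beta>: "0 < \<beta>" "\<beta> \<le> 1" and t: "t > 0"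
    and g: "\<And>x. x \<in> {0..t} \<Longrightarrow> (g has_real_derivative g' x) (at x within {0..t})"
    and M1: "\<And>y z. y \<in> {0..t} \<Longrightarrow> z \<in> {0..t} \<Longrightarrow> \<bar>g y - g z\<bar> \<le> M1 * \<bar>y - z\<bar>" "0 \<le> M1"
    and M2: "\<And>y z. y \<in> {0..t} \<Longrightarrow> z \<in> {0..t} \<Longrightarrow> \<bar>g' y - g' z\<bar> \<le> M2 * \<bar>y - z\<bar>" "0 \<le> M2"
    and mesh: "is_mesh t m x"
  shows "\<bar>(\<Sum>k=1..m. (g (x k) + g (x (k - 1))) / 2 *
             ((t - x (k - 1)) powr \<beta> - (t - x k) powr \<beta>))
          - integral {0..t} (\<lambda>x. g x * caputo_weight \<beta> t x)\<bar>
         \<le> (2 * M2 * t + M1 * \<beta> + M1 * 2 powr \<beta>) * h_max m x powr (\<beta> + 1)"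
proof -
  define h where "h = h_max m x"
  have h: "0 < h" "h \<le> t" using h_max_bounds[OF mesh] by (auto simp: h_def)
  have contg: "continuous_on {0..t} g"
    by (rule DERIV_continuous_on[OF g])
  \<comment> \<open>Cutting the kernel off at distance \<open>h\<close> from \<open>t\<close>, and its tail mass at distance \<open>2 * h\<close>, keeps both
    monotone on the whole interval. One function \<open>\<phi>\<close> then dominates the error on every panel, and
    the panel containing the cut needs no separate index.\<close>
  define P where "P x = \<beta> * (max (t - x) h) powr (\<beta> - 1)" for x
  define V where "V x = (min (t - x) (2 * h)) powr \<beta>" for x
  define \<phi> where "\<phi> x = - (2 * M2 * h^2) * (t - x) powr \<beta> + M1 * h^2 * P x - M1 * h * V x" for x
  have bound: "\<bar>panel_error \<beta> t g a b\<bar> \<le> \<phi> b - \<phi> a"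
    if ab: "0 \<le> a" "a \<le> b" "b \<le> t" "b - a \<le> h" for a b
  proof -
    have sub: "{a..b} \<subseteq> {0..t}" using ab by auto
    have osc: "\<bar>(g b + g a) / 2 - g z\<bar> \<le> M1 * h" if "z \<in> {a..b}" for z
    proof (rule panel_deviation_le[OF ab(2) that])
      fix y z assume yz: "y \<in> {a..b}" "z \<in> {a..b}"
      have "\<bar>g y - g z\<bar> \<le> M1 * \<bar>y - z\<bar>" using yz sub by (intro M1) auto
      also have "\<dots> \<le> M1 * h" using yz ab M1(2) by (intro mult_left_mono) auto
      finally show "\<bar>g y - g z\<bar> \<le> M1 * h" .
    qed
    have W: "(t - b) powr \<beta> \<le> (t - a) powr \<beta>" using ab \<beta> by (intro powr_mono2) auto
    have PP: "P a \<le> P b"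
      unfolding P_def using ab \<beta> h by (intro mult_left_mono powr_mono2') auto
    have VV: "V b \<le> V a"
      unfolding V_def using ab \<beta> h by (intro powr_mono2) auto
    have nn: "0 \<le> 2 * M2 * h^2 * ((t - a) powr \<beta> - (t - b) powr \<beta>)"
       "0 \<le> M1 * h^2 * (P b - P a)" "0 \<le> M1 * h * (V a - V b)"
      using W PP VV M1(2) M2(2) h by auto
    have "\<bar>panel_error \<beta> t g a b\<bar> \<le> 2 * M2 * h^2 * ((t - a) powr \<beta> - (t - b) powr \<beta>)
        + M1 * h^2 * (P b - P a) + M1 * h * (V a - V b)"
    proof (cases "b \<le> t - h")
      case True
      have "\<bar>integral {a..b} (\<lambda>x. (g b + g a) / 2 - g x)\<bar> \<le> 2 * M2 * (b - a)^2 * (b - a)"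
      proof (rule trapezoid_defect_le[OF ab(2)])
        show "(g has_real_derivative g' z) (at z within {a..b})" if "z \<in> {a..b}" for z
          using g[of z] that sub by (blast intro: DERIV_subset)
        show "\<bar>g' z - g' a\<bar> \<le> M2 * (b - a)" if z: "z \<in> {a..b}" for z
        proof -
          have "\<bar>g' z - g' a\<bar> \<le> M2 * \<bar>z - a\<bar>" using z ab by (intro M2) auto
          also have "\<dots> \<le> M2 * (b - a)" using z M2(2) by (intro mult_left_mono) auto
          finally show ?thesis .
        qed
      qed
      also have "\<dots> \<le> 2 * M2 * h^2 * (b - a)"
        using ab M2(2) by (intro mult_right_mono mult_left_mono power_mono) auto
      finally have defect: "\<bar>integral {a..b} (\<lambda>x. (g b + g a) / 2 - g x)\<bar>
          \<le> 2 * M2 * h^2 * (b - a)" .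
      have far: "caputo_weight \<beta> t b = P b" "caputo_weight \<beta> t a = P a"
        using True ab by (simp_all add: caputo_weight_def P_def max_absorb1)
      have "\<bar>panel_error \<beta> t g a b\<bar> \<le> M1 * h * (b - a) * (P b - P a)
          + 2 * M2 * h^2 * ((t - a) powr \<beta> - (t - b) powr \<beta>)"
        unfolding far[symmetric] using True ab h \<beta> M2(2) continuous_on_subset[OF contg sub]
        by (intro panel_error_refined osc defect) auto
      moreover have "M1 * h * (b - a) * (P b - P a) \<le> M1 * h * h * (P b - P a)"
        using ab PP h M1(2) by (intro mult_right_mono mult_left_mono) auto
      ultimately show ?thesis using nn by (simp add: power2_eq_square mult.assoc)
    next
      case False
      \<comment> \<open>Here \<open>t - b < h\<close> and \<open>b - a \<le> h\<close>, so the whole panel is within \<open>2 * h\<close> of \<open>t\<close>.\<close>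
      have near: "V a = (t - a) powr \<beta>" "V b = (t - b) powr \<beta>"
        using False ab h by (auto simp: V_def min_def)
      have "\<bar>panel_error \<beta> t g a b\<bar> \<le> M1 * h * (V a - V b)"
        unfolding near using ab \<beta> continuous_on_subset[OF contg sub]
        by (intro panel_error_crude osc) auto
      then show ?thesis using nn by linarith
    qed
    then show ?thesis by (simp add: \<phi>_def algebra_simps)
  qed
  have "\<phi> t - \<phi> 0 = 2 * M2 * h^2 * t powr \<beta> + M1 * h^2 * (P t - P 0) + M1 * h * V 0"
    using h by (simp add: \<phi>_def V_def algebra_simps)
  also have "\<dots> \<le> 2 * M2 * t * h powr (\<beta> + 1) + M1 * \<beta> * h powr (\<beta> + 1)
      + M1 * 2 powr \<beta> * h powr (\<beta> + 1)"
  proof (intro add_mono)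
    have pow: "h powr (\<beta> + 1) = h * h powr \<beta>" "h^2 * h powr (\<beta> - 1) = h powr (\<beta> + 1)"
      using h by (simp_all add: powr_add powr_diff power2_eq_square)
    have "h^2 * t powr \<beta> = h powr (\<beta> + 1) * (h powr (1 - \<beta>) * t powr \<beta>)"
      using h by (simp add: powr_add powr_diff power2_eq_square)
    also have "\<dots> \<le> h powr (\<beta> + 1) * (t powr (1 - \<beta>) * t powr \<beta>)"
      using h \<beta> by (intro mult_left_mono mult_right_mono powr_mono2) auto
    also have "t powr (1 - \<beta>) * t powr \<beta> = t" using t by (simp add: powr_add[symmetric])
    finally have "2 * M2 * (h^2 * t powr \<beta>) \<le> 2 * M2 * (h powr (\<beta> + 1) * t)"
      using M2(2) by (intro mult_left_mono) auto
    then show "2 * M2 * h^2 * t powr \<beta> \<le> 2 * M2 * t * h powr (\<beta> + 1)"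
      by (simp add: mult_ac)
    have "P t - P 0 \<le> \<beta> * h powr (\<beta> - 1)"
      using \<beta> h by (simp add: P_def)
    then have "M1 * h^2 * (P t - P 0) \<le> M1 * h^2 * (\<beta> * h powr (\<beta> - 1))"
      using M1(2) by (intro mult_left_mono) auto
    also have "\<dots> = M1 * \<beta> * h powr (\<beta> + 1)" by (simp add: pow(2)[symmetric] mult_ac)
    finally show "M1 * h^2 * (P t - P 0) \<le> M1 * \<beta> * h powr (\<beta> + 1)" .
    have "V 0 \<le> (2 * h) powr \<beta>"
      unfolding V_def using h t \<beta> by (intro powr_mono2) auto
    then have "M1 * h * V 0 \<le> M1 * h * (2 * h) powr \<beta>"
      using M1(2) h by (intro mult_left_mono) auto
    also have "\<dots> = M1 * 2 powr \<beta> * h powr (\<beta> + 1)"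
      using h by (simp add: pow(1) powr_mult)
    finally show "M1 * h * V 0 \<le> M1 * 2 powr \<beta> * h powr (\<beta> + 1)" .
  qed
  also have "\<dots> = (2 * M2 * t + M1 * \<beta> + M1 * 2 powr \<beta>) * h powr (\<beta> + 1)"
    by (simp add: algebra_simps)
  finally show ?thesis
    using mesh_error_le[OF \<beta>(1) contg mesh, of \<phi>] bound by (simp add: h_def)
qed


section \<open>Higher derivatives relative to an interval\<close>

lemma higher_deriv_within_has_derivative:
  assumes "C_k_on k {0..t} f" "j < k" "t > 0" "x \<in> {0..t}"
  shows "(higher_deriv_within {0..t} j f has_real_derivative higher_deriv_within {0..t} (Suc j) f x)
           (at x within {0..t})"
proof -
  have "higher_deriv_within {0..t} j f differentiable (at x within {0..t})"
    using assms by (auto simp: C_k_on_def differentiable_on_def)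
  then show ?thesis
    unfolding has_real_derivative_iff_has_vector_derivative
    by (simp add: higher_deriv_within_def vector_derivative_works)
qed

lemma C1_interval_lipschitz:
  fixes g g' :: "real \<Rightarrow> real"
  assumes "\<And>x. x \<in> {a..b} \<Longrightarrow> (g has_real_derivative g' x) (at x within {a..b})"
    and "continuous_on {a..b} g'"
  obtains M where "0 \<le> M"
    and "\<And>y z. y \<in> {a..b} \<Longrightarrow> z \<in> {a..b} \<Longrightarrow> \<bar>g y - g z\<bar> \<le> M * \<bar>y - z\<bar>"
proof -
  have "bounded (g' ` {a..b})"
    by (intro compact_imp_bounded compact_continuous_image assms(2)) simp
  then obtain M where M: "M > 0" "\<And>x. x \<in> {a..b} \<Longrightarrow> norm (g' x) \<le> M"
    by (auto simp: bounded_pos)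
  have "norm (g y - g z) \<le> M * norm (y - z)" if "y \<in> {a..b}" "z \<in> {a..b}" for y z
    using that M assms(1) by (intro field_differentiable_bound[of "{a..b}" g g']) auto
  with M(1) show ?thesis by (intro that[of M]) auto
qed

theorem theorem1:
  fixes \<alpha> t C :: real and n :: nat and f :: "real \<Rightarrow> real"
  assumes "\<alpha> > 0" and "real n - 1 \<le> \<alpha>" and "\<alpha> < real n"
    and "t > 0" and "t \<le> C"
    and "C_k_on n {0..t} f"
  shows "caputo \<alpha> n f t =
           1 / Gamma (real n + 1 - \<alpha>) *
           integral {0..t powr (real n - \<alpha>)}
             (\<lambda>u. higher_deriv_within {0..t} n f (t - u powr (1 / (real n - \<alpha>))))
       \<and> (\<forall>D. D = 1 / Gamma (real n + 1 - \<alpha>) *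
                  integral {0..t powr (real n - \<alpha>)}
                    (\<lambda>u. higher_deriv_within {0..t} n f (t - u powr (1 / (real n - \<alpha>))))
            \<longleftrightarrow> ((\<lambda>(m, x). caputo_trapezoid \<alpha> n f t m x) \<longlongrightarrow> D) (fine_meshes t C))
       \<and> (C_k_on (n + 2) {0..t} f \<longrightarrow>
            (\<lambda>(m, x). caputo \<alpha> n f t - caputo_trapezoid \<alpha> n f t m x)
              \<in> O[fine_meshes t C](\<lambda>(m, x). h_max m x powr (real n - \<alpha> + 1)))"
proof -
  define \<beta> where "\<beta> = real n - \<alpha>"
  define g where "g = higher_deriv_within {0..t} n f"
  define c where "c = 1 / Gamma (real n + 1 - \<alpha>)"
  define J where "J = integral {0..t} (\<lambda>x. g x * caputo_weight \<beta> t x)"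
  define S where "S m x = (\<Sum>k=1..m. (g (x k) + g (x (k - 1))) / 2 *
      ((t - x (k - 1)) powr \<beta> - (t - x k) powr \<beta>))" for m and x :: "nat \<Rightarrow> real"
  have \<beta>: "0 < \<beta>" "\<beta> \<le> 1" using assms by (auto simp: \<beta>_def)
  have g: "continuous_on {0..t} g" using assms by (simp add: C_k_on_def g_def)
  have trapezoid: "caputo_trapezoid \<alpha> n f t m x = c * S m x" for m x
    by (simp add: caputo_trapezoid_def c_def S_def g_def \<beta>_def)
  have caputo: "caputo \<alpha> n f t = c * J"
    using caputo_eq_weighted_integral[OF assms(3)] by (simp add: c_def J_def g_def \<beta>_def)
  have J: "J = integral {0..t powr \<beta>} (\<lambda>u. g (t - u powr (1 / \<beta>)))"
    using integral_unique[OF weighted_integral_substitution[OF \<beta>(1), of 0 t t g]] g assms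
    by (simp add: J_def)
  have "((\<lambda>(m, x). S m x) \<longlongrightarrow> J) (fine_meshes t C)"
    unfolding S_def J_def by (rule trapezoid_tendsto_weighted_integral[OF \<beta>(1) assms(4) g])
  then have lim: "((\<lambda>(m, x). caputo_trapezoid \<alpha> n f t m x) \<longlongrightarrow> c * J) (fine_meshes t C)"
    unfolding trapezoid case_prod_beta by (intro tendsto_intros)
  have "D = c * J \<longleftrightarrow> ((\<lambda>(m, x). caputo_trapezoid \<alpha> n f t m x) \<longlongrightarrow> D) (fine_meshes t C)" for D
    using lim tendsto_unique[OF fine_meshes_neq_bot[OF assms(4,5)] _ lim] by blast
  moreover have "(\<lambda>(m, x). caputo \<alpha> n f t - caputo_trapezoid \<alpha> n f t m x)
      \<in> O[fine_meshes t C](\<lambda>(m, x). h_max m x powr (\<beta> + 1))"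
    if C2: "C_k_on (n + 2) {0..t} f"
  proof -
    define g' where "g' = higher_deriv_within {0..t} (Suc n) f"
    define g'' where "g'' = higher_deriv_within {0..t} (Suc (Suc n)) f"
    have g': "(g has_real_derivative g' x) (at x within {0..t})" if "x \<in> {0..t}" for x
      unfolding g_def g'_def
      by (rule higher_deriv_within_has_derivative[OF C2 _ assms(4) that]) simp
    have g'': "(g' has_real_derivative g'' x) (at x within {0..t})" if "x \<in> {0..t}" for x
      unfolding g'_def g''_def
      by (rule higher_deriv_within_has_derivative[OF C2 _ assms(4) that]) simp
    have cont': "continuous_on {0..t} g'"
      by (rule DERIV_continuous_on[OF g''])
    have cont'': "continuous_on {0..t} g''"
      using C2 by (simp add: C_k_on_def g''_def)
    obtain M1 where M1: "0 \<le> M1"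
      "\<And>y z. y \<in> {0..t} \<Longrightarrow> z \<in> {0..t} \<Longrightarrow> \<bar>g y - g z\<bar> \<le> M1 * \<bar>y - z\<bar>"
      using C1_interval_lipschitz[OF g' cont'] by blast
    obtain M2 where M2: "0 \<le> M2"
      "\<And>y z. y \<in> {0..t} \<Longrightarrow> z \<in> {0..t} \<Longrightarrow> \<bar>g' y - g' z\<bar> \<le> M2 * \<bar>y - z\<bar>"
      using C1_interval_lipschitz[OF g'' cont''] by blast
    define K where "K = 2 * M2 * t + M1 * \<beta> + M1 * 2 powr \<beta>"
    have rate: "\<bar>S m x - J\<bar> \<le> K * h_max m x powr (\<beta> + 1)" if "is_mesh t m x" for m x
      unfolding S_def J_def K_def
      by (rule trapezoid_error_rate[OF \<beta> assms(4) g' M1(2,1) M2(2,1) that])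
    show ?thesis
    proof (rule bigoI[of _ "\<bar>c\<bar> * K"], rule eventually_fine_meshesI[of 1])
      fix m x assume "is_mesh t m x"
      then have "\<bar>c\<bar> * \<bar>S m x - J\<bar> \<le> \<bar>c\<bar> * (K * h_max m x powr (\<beta> + 1))"
        by (intro mult_left_mono rate) auto
      moreover have "\<bar>c * J - c * S m x\<bar> = \<bar>c\<bar> * \<bar>S m x - J\<bar>"
        by (simp add: right_diff_distrib[symmetric] abs_mult abs_minus_commute)
      ultimately show "norm (case (m, x) of (m, x) \<Rightarrow> caputo \<alpha> n f t - caputo_trapezoid \<alpha> n f t m x)
          \<le> \<bar>c\<bar> * K * norm (case (m, x) of (m, x) \<Rightarrow> h_max m x powr (\<beta> + 1))"
        by (simp add: caputo trapezoid mult.assoc)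
    qed simp
  qed
  ultimately show ?thesis
    unfolding caputo \<beta>_def[symmetric] g_def[symmetric] c_def[symmetric] J[symmetric] by blast
qed

end
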